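(* A coarse disjoint union of a sequence of ghostly measured asymptotic expanders with uniformly bounded geometry cannot coarsely embed into any $L^p$-space for $p\in[1,\infty)$.
   Context: A sequence of finite measured metric spaces $\{(X_n,d_n,m_n)\}_{n\in\mathbb N}$ consists of finite metric spaces with non-trivial finite measures $m_n$ on all subsets of $X_n$. It has uniformly bounded geometry if $\sup_n\sup_{x\in X_n}|B(x,R)|<\infty$ for every $R>0$ (closed balls). It is ghostly if $\lim_{n\to\infty}\sup_{x\in X_n}\frac{m_n(x)}{m_n(X_n)}=0$. It is a sequence of measured asymptotic expanders if for every $\alpha\in(0,\frac12]$ there exist $c_\alpha\in(0,1)$ and $R_\alpha>0$ such that for every $n$ and every $A\subseteq X_n$ with $\alpha\,m_n(X_n)\le m_n(A)\le\frac12m_n(X_n)$ one has $m_n(\partial_{R_\alpha}A)>c_\alpha m_n(A)$, where $\partial_RA=\{x\in X_n\setminus A:d_n(x,A)\le R\}$. A coarse disjoint union of $\{(X_n,d_n)\}_n$ is a metric space $(X,d)$ with $X=\bigsqcup_nX_n$, $d|_{X_n}=d_n$, and $d(X_n,X_m)\to\infty$ as $n+m\to\infty$, $n\ne m$. An $L^p$-space is $L^p(Z,\nu)$ for some measure space. A map $f:X\to Y$ between metric spaces is a coarse embedding if there are non-decreasing unbounded $\rho_\pm:[0,\infty)\to[0,\infty)$ with $\rho_-(d_X(x,y))\le d_Y(f(x),f(y))\le\rho_+(d_X(x,y))$ for all $x,y$. *)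

theory Defs
  imports "HOL-Analysis.Analysis"
begin

section \<open>Finite measured metric spaces\<close>

definition finite_measured_metric_space ::
    "'a set \<Rightarrow> ('a \<Rightarrow> 'a \<Rightarrow> real) \<Rightarrow> 'a measure \<Rightarrow> bool" where
  "finite_measured_metric_space X d m \<longleftrightarrow>
     Metric_space X d \<and> finite X \<and>
     finite_measure m \<and> space m = X \<and> sets m = Pow X \<and> measure m X \<noteq> 0"

text \<open>The distance is extended real, so that the distance to the empty set is infinite.\<close>

definition set_dist :: "('a \<Rightarrow> 'a \<Rightarrow> real) \<Rightarrow> 'a set \<Rightarrow> 'a set \<Rightarrow> ereal" where
  "set_dist d A B = (INF a\<in>A. INF b\<in>B. ereal (d a b))"

definition outer_boundary ::
    "'a set \<Rightarrow> ('a \<Rightarrow> 'a \<Rightarrow> real) \<Rightarrow> real \<Rightarrow> 'a set \<Rightarrow> 'a set" where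
  "outer_boundary X d R A = {x \<in> X - A. set_dist d {x} A \<le> ereal R}"

definition uniformly_bounded_geometry ::
    "(nat \<Rightarrow> 'a set) \<Rightarrow> (nat \<Rightarrow> 'a \<Rightarrow> 'a \<Rightarrow> real) \<Rightarrow> bool" where
  "uniformly_bounded_geometry X d \<longleftrightarrow>
     (\<forall>R>0. \<exists>K::nat. \<forall>n. \<forall>x\<in>X n. card (Metric_space.mcball (X n) (d n) x R) \<le> K)"

definition ghostly :: "(nat \<Rightarrow> 'a set) \<Rightarrow> (nat \<Rightarrow> 'a measure) \<Rightarrow> bool" where
  "ghostly X m \<longleftrightarrow>
     (\<lambda>n. SUP x\<in>X n. measure (m n) {x} / measure (m n) (X n)) \<longlonglongrightarrow> 0"

definition measured_asymptotic_expanders ::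
    "(nat \<Rightarrow> 'a set) \<Rightarrow> (nat \<Rightarrow> 'a \<Rightarrow> 'a \<Rightarrow> real) \<Rightarrow> (nat \<Rightarrow> 'a measure) \<Rightarrow> bool" where
  "measured_asymptotic_expanders X d m \<longleftrightarrow>
     (\<forall>n. finite_measured_metric_space (X n) (d n) (m n)) \<and>
     (\<forall>\<alpha>. 0 < \<alpha> \<and> \<alpha> \<le> 1/2 \<longrightarrow>
        (\<exists>c R. 0 < c \<and> c < 1 \<and> 0 < R \<and>
           (\<forall>n. \<forall>A\<subseteq>X n.
              \<alpha> * measure (m n) (X n) \<le> measure (m n) A \<and>
              measure (m n) A \<le> 1/2 * measure (m n) (X n) \<longrightarrow>
              measure (m n) (outer_boundary (X n) (d n) R A) > c * measure (m n) A)))"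

section \<open>Coarse disjoint unions and coarse embeddings\<close>

text \<open>The point \<open>x\<close> of the \<open>n\<close>-th space is the pair \<open>(n, x)\<close> of the disjoint union
  \<open>Sigma UNIV X\<close>.\<close>

definition coarse_disjoint_union ::
    "(nat \<Rightarrow> 'a set) \<Rightarrow> (nat \<Rightarrow> 'a \<Rightarrow> 'a \<Rightarrow> real) \<Rightarrow> (nat \<times> 'a \<Rightarrow> nat \<times> 'a \<Rightarrow> real) \<Rightarrow> bool" where
  "coarse_disjoint_union X \<delta> d \<longleftrightarrow>
     Metric_space (Sigma UNIV X) d \<and>
     (\<forall>n. \<forall>x\<in>X n. \<forall>y\<in>X n. d (n, x) (n, y) = \<delta> n x y) \<and>
     (\<forall>K::real. \<exists>N. \<forall>i j. i \<noteq> j \<and> i + j \<ge> N \<longrightarrow>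
        set_dist d ({i} \<times> X i) ({j} \<times> X j) \<ge> ereal K)"

definition control_function :: "(real \<Rightarrow> real) \<Rightarrow> bool" where
  "control_function \<rho> \<longleftrightarrow>
     \<rho> \<in> {0..} \<rightarrow> {0..} \<and> mono_on {0..} \<rho> \<and> \<not> bdd_above (\<rho> ` {0..})"

definition coarse_embedding ::
    "'a set \<Rightarrow> ('a \<Rightarrow> 'a \<Rightarrow> real) \<Rightarrow> 'b set \<Rightarrow> ('b \<Rightarrow> 'b \<Rightarrow> real) \<Rightarrow> ('a \<Rightarrow> 'b) \<Rightarrow> bool" where
  "coarse_embedding X d\<^sub>X Y d\<^sub>Y f \<longleftrightarrow>
     f \<in> X \<rightarrow> Y \<and>
     (\<exists>\<rho>\<^sub>1 \<rho>\<^sub>2. control_function \<rho>\<^sub>1 \<and> control_function \<rho>\<^sub>2 \<and>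
        (\<forall>x\<in>X. \<forall>y\<in>X. \<rho>\<^sub>1 (d\<^sub>X x y) \<le> d\<^sub>Y (f x) (f y) \<and> d\<^sub>Y (f x) (f y) \<le> \<rho>\<^sub>2 (d\<^sub>X x y)))"

section \<open>\<open>L\<^sup>p\<close>-spaces\<close>

text \<open>The scalars \<open>'k\<close> are meant to be \<open>real\<close> or \<open>complex\<close>; up to isomorphism these are the only
  instances of the two classes together. Elements of the space are classes of
  functions modulo equality almost everywhere.\<close>

definition Lp_functions ::
    "real \<Rightarrow> 'z measure \<Rightarrow> ('z \<Rightarrow> 'k::{real_normed_field, euclidean_space}) set" where
  "Lp_functions p M = {f \<in> borel_measurable M. integrable M (\<lambda>z. norm (f z) powr p)}"

definition Lp_rel ::
    "real \<Rightarrow> 'z measure \<Rightarrow> ('z \<Rightarrow> 'k::{real_normed_field, euclidean_space}) rel" where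
  "Lp_rel p M =
     {(f, g). f \<in> Lp_functions p M \<and> g \<in> Lp_functions p M \<and> (AE z in M. f z = g z)}"

definition Lp_space ::
    "real \<Rightarrow> 'z measure \<Rightarrow> ('z \<Rightarrow> 'k::{real_normed_field, euclidean_space}) set set" where
  "Lp_space p M = Lp_functions p M // Lp_rel p M"

definition Lp_dist ::
    "real \<Rightarrow> 'z measure \<Rightarrow> ('z \<Rightarrow> 'k::{real_normed_field, euclidean_space}) set \<Rightarrow> ('z \<Rightarrow> 'k) set \<Rightarrow> real"
  where
  "Lp_dist p M F G =
     (LINT z|M. norm ((SOME f. f \<in> F) z - (SOME g. g \<in> G) z) powr p) powr (1 / p)"

lemma equiv_Lp_rel: "equiv (Lp_functions p M) (Lp_rel p M)"
proof (rule equivI)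
  show "Lp_rel p M \<subseteq> Lp_functions p M \<times> Lp_functions p M"
    by (auto simp: Lp_rel_def)
  show "refl_on (Lp_functions p M) (Lp_rel p M)"
    by (auto simp: refl_on_def Lp_rel_def)
  show "sym (Lp_rel p M)"
    by (auto simp: sym_def Lp_rel_def elim: eventually_mono)
  show "trans (Lp_rel p M)"
    by (auto simp: trans_def Lp_rel_def elim: eventually_elim2)
qed

text \<open>The choice of representatives in \<open>Lp_dist\<close> is immaterial.\<close>

lemma Lp_dist_eq:
  fixes f g :: "'z \<Rightarrow> 'k::{real_normed_field, euclidean_space}"
  assumes F: "F \<in> Lp_space p M" "f \<in> F" and G: "G \<in> Lp_space p M" "g \<in> G"
  shows "Lp_dist p M F G = (LINT z|M. norm (f z - g z) powr p) powr (1 / p)"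
proof -
  define f' where "f' = (SOME h. h \<in> F)"
  define g' where "g' = (SOME h. h \<in> G)"
  have "f' \<in> F" "g' \<in> G"
    unfolding f'_def g'_def using F(2) G(2) by (simp_all add: some_in_eq) blast+
  hence "(f', f) \<in> Lp_rel p M" "(g', g) \<in> Lp_rel p M"
    using F G in_quotient_imp_in_rel[OF equiv_Lp_rel, of F p M f' f]
      in_quotient_imp_in_rel[OF equiv_Lp_rel, of G p M g' g]
    by (simp_all add: Lp_space_def)
  hence meas: "f \<in> borel_measurable M" "f' \<in> borel_measurable M"
      "g \<in> borel_measurable M" "g' \<in> borel_measurable M"
    and ae: "AE z in M. f' z = f z" "AE z in M. g' z = g z"
    by (auto simp: Lp_rel_def Lp_functions_def)
  have "(LINT z|M. norm (f' z - g' z) powr p) = (LINT z|M. norm (f z - g z) powr p)"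
    using meas ae by (intro integral_cong_AE) auto
  thus ?thesis
    by (simp add: Lp_dist_def f'_def g'_def)
qed

end

theory Submission
  imports Defs
begin

text \<open>Each asymptotic expander contains a subset of at least half of its weight which expands on all
  scales. On it, integrating expansion over level sets gives a Poincare inequality for \<open>p\<close>-th powers
  of scalar functions, with constants independent of \<open>n\<close>; integrating over the base of the
  \<open>L\<^sup>p\<close>-space gives it for \<open>L\<^sup>p\<close>-valued maps. Hence under a coarse embedding the mean of
  \<open>\<parallel>f x - f y\<parallel>\<^sup>p\<close> over the subset is bounded, so a fixed proportion of the weight lies in a
  ball of fixed radius. Such balls have boundedly many points, which contradicts ghostliness.

  As the weights of neighbouring points need not be comparable, the Poincare inequality is not
  symmetrised: in \<open>\<bar>g y\<bar>\<^sup>p \<le> (1 + \<epsilon>) \<bar>g x\<bar>\<^sup>p + C \<bar>g y - g x\<bar>\<^sup>p\<close> all terms carry the weight of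
  \<open>x\<close>, and the \<open>\<epsilon>\<close>-term is absorbed by the left-hand side.\<close>

section \<open>Elementary inequalities for powers\<close>

text \<open>Every summand is at most the largest one, whose power is one of the terms on the right.
  The constant is cruder than the one convexity would give, but it works for every
  \<open>p \<ge> 0\<close>.\<close>

lemma powr_sum_le:
  fixes a :: "'i \<Rightarrow> real"
  assumes S: "finite S" and a: "\<And>i. i \<in> S \<Longrightarrow> 0 \<le> a i" and p: "0 \<le> p"
  shows "(\<Sum>i\<in>S. a i) powr p \<le> real (card S) powr p * (\<Sum>i\<in>S. a i powr p)"
proof (cases "S = {}")
  case False
  obtain j where j: "j \<in> S" "\<And>i. i \<in> S \<Longrightarrow> a i \<le> a j"
    using obtains_MAX[OF S False, of a] S by (metis Max_ge finite_imageI image_eqI)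
  have "(\<Sum>i\<in>S. a i) powr p \<le> (real (card S) * a j) powr p"
    using sum_bounded_above[of S a "a j"] j a p by (intro powr_mono2) (auto intro: sum_nonneg)
  also have "\<dots> = real (card S) powr p * a j powr p"
    using a j by (simp add: powr_mult)
  also have "\<dots> \<le> real (card S) powr p * (\<Sum>i\<in>S. a i powr p)"
    using member_le_sum[of j S "\<lambda>i. a i powr p"] j S by (intro mult_left_mono) auto
  finally show ?thesis .
qed simp

lemma powr_add_le:
  fixes a b p :: real
  assumes "0 \<le> a" "0 \<le> b" "0 \<le> p"
  shows "(a + b) powr p \<le> 2 powr p * (a powr p + b powr p)"
  using powr_sum_le[of "UNIV :: bool set" "\<lambda>i. if i then a else b" p] assms
  by (simp add: UNIV_bool add.commute)

text \<open>The leading constant may be taken arbitrarily close to 1, which the later absorption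
  argument requires. Take \<open>l\<close> with \<open>(1 + l) powr p = 1 + e\<close>. If
  \<open>b \<le> l * a\<close>, the sum is at most \<open>(1 + l) * a\<close>; otherwise
  \<open>a\<close> is at most \<open>b / l\<close> and the whole sum is controlled by
  \<open>b\<close>.\<close>

lemma powr_add_le_weighted:
  fixes p e :: real
  assumes p: "0 < p" and e: "0 < e"
  obtains C where "0 \<le> C"
    "\<And>a b. 0 \<le> a \<Longrightarrow> 0 \<le> b \<Longrightarrow> (a + b) powr p \<le> (1 + e) * a powr p + C * b powr p"
proof -
  define l where "l = (1 + e) powr (1 / p) - 1"
  have l: "0 < l"
    using p e by (simp add: l_def)
  have l1: "(1 + l) powr p = 1 + e"
    using p e by (simp add: l_def powr_powr)
  have "(a + b) powr p \<le> (1 + e) * a powr p + (1 / l + 1) powr p * b powr p"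
    if ab: "0 \<le> a" "0 \<le> b" for a b
  proof (cases "b \<le> l * a")
    case True
    have "(a + b) powr p \<le> ((1 + l) * a) powr p"
      using True ab p by (intro powr_mono2) (auto simp: algebra_simps)
    also have "\<dots> = (1 + e) * a powr p"
      using ab l by (simp add: powr_mult l1)
    finally show ?thesis by (simp add: add_increasing2)
  next
    case False
    have "a \<le> b / l"
      using False l by (simp add: field_simps)
    hence "(a + b) powr p \<le> ((1 / l + 1) * b) powr p"
      using ab p by (intro powr_mono2) (auto simp: algebra_simps)
    also have "\<dots> = (1 / l + 1) powr p * b powr p"
      using ab l by (simp add: powr_mult)
    finally show ?thesis using e by (simp add: add_increasing)
  qed
  thus ?thesis by (intro that[of "(1 / l + 1) powr p"]) auto
qed

section \<open>Vertex expansion and Poincare inequalities\<close>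

definition vertex_boundary :: "('a \<Rightarrow> 'a \<Rightarrow> bool) \<Rightarrow> 'a set \<Rightarrow> 'a set \<Rightarrow> 'a set" where
  "vertex_boundary E Y A = {x \<in> Y - A. \<exists>a\<in>A. E x a}"

text \<open>In contrast to asymptotic expansion there is no lower bound on the weight of
  \<open>A\<close>: sets of arbitrarily small weight expand too. The inequality is non-strict so
  that it can hold for sets of weight zero, such as the empty set.\<close>

definition vertex_expander ::
    "real \<Rightarrow> ('a \<Rightarrow> 'a \<Rightarrow> bool) \<Rightarrow> ('a \<Rightarrow> real) \<Rightarrow> 'a set \<Rightarrow> bool" where
  "vertex_expander c E w Y \<longleftrightarrow> finite Y \<and> (\<forall>x\<in>Y. 0 \<le> w x) \<and>
     (\<forall>A\<subseteq>Y. sum w A \<le> sum w Y / 2 \<longrightarrow> c * sum w A \<le> sum w (vertex_boundary E Y A))"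

text \<open>The set removed is a non-expanding set of maximal small weight: adding a further non-expanding
  set to it would either keep it small or produce a non-expanding set of intermediate
  weight. Past half of the total weight, the complement of the closed neighbourhood takes the role
  of the set, because its outer boundary lies in the outer boundary of the original one.\<close>

lemma vertex_expander_subset:
  fixes w :: "'a \<Rightarrow> real"
  assumes X: "finite X" and w: "\<And>x. x \<in> X \<Longrightarrow> 0 \<le> w x" and W: "0 < sum w X"
    and sym: "\<And>x y. E x y \<Longrightarrow> E y x" and c: "0 < c" "c < 1"
    and exp: "\<And>A. A \<subseteq> X \<Longrightarrow> sum w X / 4 \<le> sum w A \<Longrightarrow> sum w A \<le> sum w X / 2 \<Longrightarrow>
        c * sum w A < sum w (vertex_boundary E X A)"
  obtains Y where "Y \<subseteq> X" "sum w X / 2 \<le> sum w Y" "vertex_expander (c / 8) E w Y"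
proof -
  let ?b = "vertex_boundary E X"
  define W where "W = sum w X"
  \<comment> \<open>The factor 1/8 serves twice: it keeps the boundary of \<open>U\<close> below
    below \<open>W / 8\<close>, and \<open>c / 8 * W\<close> lies below \<open>c * (W / 4)\<close>,
    the lower bound for the expansion of \<open>B\<close>.\<close>
  define bad where "bad = {F. F \<subseteq> X \<and> sum w F \<le> W / 2 \<and> sum w (?b F) \<le> c / 8 * sum w F}"
  have mono: "sum w A \<le> sum w B" if "A \<subseteq> B" "B \<subseteq> X" for A B
    using that w X by (intro sum_mono2) (auto intro: finite_subset)
  have disj: "sum w (A \<union> B) = sum w A + sum w B" if "A \<inter> B = {}" "A \<subseteq> X" "B \<subseteq> X" for A B
    using that X by (intro sum.union_disjoint) (auto intro: finite_subset)
  have le: "sum w (A \<union> B) \<le> sum w A + sum w B" if "A \<subseteq> X" "B \<subseteq> X" for A B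
  proof -
    have "sum w (A \<union> (B - A)) = sum w A + sum w (B - A)" using that by (intro disj) auto
    moreover have "sum w (B - A) \<le> sum w B" using that by (intro mono) auto
    ultimately show ?thesis by simp
  qed
  have bX: "?b A \<subseteq> X" for A by (auto simp: vertex_boundary_def)
  have "finite bad" using X by (auto simp: bad_def intro: finite_subset[of _ "Pow X"])
  moreover have "{} \<in> bad" using W by (simp add: bad_def W_def vertex_boundary_def)
  ultimately obtain F where F: "F \<in> bad" "\<And>G. G \<in> bad \<Longrightarrow> sum w G \<le> sum w F"
    using obtains_MAX[of bad "sum w"] by (metis Max_ge empty_iff finite_imageI image_eqI)
  hence FX: "F \<subseteq> X" and F2: "sum w F \<le> W / 2" and Fb: "sum w (?b F) \<le> c / 8 * sum w F"
    by (auto simp: bad_def)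
  have F0: "0 \<le> sum w F" using FX w by (intro sum_nonneg) auto
  have F4: "sum w F < W / 4"
  proof (rule ccontr)
    assume "\<not> ?thesis"
    hence "c * sum w F < sum w (?b F)" using exp[of F] FX F2 by (simp add: W_def)
    moreover have "c / 8 * sum w F \<le> c * sum w F" using c F0 by (intro mult_right_mono) auto
    ultimately show False using Fb by linarith
  qed
  define Y where "Y = X - F"
  have YX: "Y \<subseteq> X" by (auto simp: Y_def)
  have WF: "W = sum w F + sum w Y"
    using disj[of F Y] FX by (simp add: W_def Y_def Un_absorb1)
  have "c / 8 * sum w A \<le> sum w (vertex_boundary E Y A)"
    if A: "A \<subseteq> Y" "sum w A \<le> sum w Y / 2" for A
  proof (rule ccontr)
    assume "\<not> ?thesis"
    hence nexp: "sum w (vertex_boundary E Y A) < c / 8 * sum w A" by simp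
    moreover have "0 \<le> sum w (vertex_boundary E Y A)"
      using w by (intro sum_nonneg) (auto simp: vertex_boundary_def Y_def)
    ultimately have "0 < c / 8 * sum w A" by linarith
    hence A0: "0 < sum w A" using c by (simp add: zero_less_mult_iff)
    define U where "U = F \<union> A"
    have UX: "U \<subseteq> X" and wU: "sum w U = sum w F + sum w A"
      using disj[of F A] A FX by (auto simp: U_def Y_def)
    \<comment> \<open>Neighbours of \<open>A\<close> that lie in \<open>F\<close> belong to
      \<open>U\<close>, so \<open>A\<close> contributes only its boundary inside
      \<open>Y\<close>.\<close>
    have "sum w (?b U) \<le> sum w (?b F \<union> vertex_boundary E Y A)"
      by (intro mono) (auto simp: U_def Y_def vertex_boundary_def)
    also have "\<dots> \<le> sum w (?b F) + sum w (vertex_boundary E Y A)"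
      by (intro le) (auto simp: Y_def vertex_boundary_def)
    finally have bU: "sum w (?b U) \<le> c / 8 * sum w U"
      using Fb nexp by (simp add: wU algebra_simps)
    have "\<not> sum w U \<le> W / 2"
    proof
      assume "sum w U \<le> W / 2"
      hence "U \<in> bad" using UX bU by (simp add: bad_def)
      from F(2)[OF this] show False using A0 wU by simp
    qed
    define B where "B = X - U - ?b U"
    have BX: "B \<subseteq> X" by (auto simp: B_def)
    have "W = sum w (U \<union> ?b U \<union> B)"
      unfolding W_def using UX bX[of U] by (intro arg_cong[of _ _ "sum w"]) (auto simp: B_def)
    also have "\<dots> = sum w (U \<union> ?b U) + sum w B"
      using UX bX[of U] BX by (intro disj) (auto simp: B_def)
    also have "sum w (U \<union> ?b U) = sum w U + sum w (?b U)"
      using UX bX[of U] by (intro disj) (auto simp: vertex_boundary_def)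
    finally have WB: "W = sum w U + sum w (?b U) + sum w B" .
    have UW: "sum w U \<le> W" using mono[OF UX] by (simp add: W_def)
    have bU0: "0 \<le> sum w (?b U)" using w bX[of U] by (intro sum_nonneg) auto
    have "c / 8 * sum w U \<le> c / 8 * W" using UW c by (intro mult_left_mono) auto
    moreover have "c / 8 * W \<le> 1 / 8 * W" using c W by (intro mult_right_mono) (auto simp: W_def)
    ultimately have bUW: "sum w (?b U) \<le> c / 8 * W" "sum w (?b U) \<le> W / 8" using bU by auto
    \<comment> \<open>\<open>U\<close> weighs at most \<open>(W + sum w F) / 2\<close>, which is
      less than 5/8 of \<open>W\<close>, and its boundary at most 1/8 of \<open>W\<close>. At least
      a quarter is left, so \<open>B\<close> is in the range where \<open>exp\<close>
      applies.\<close>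
    have B4: "W / 4 \<le> sum w B" using WB bUW WF wU A(2) F4 by simp
    have "sum w B \<le> W / 2" using WB bU0 \<open>\<not> sum w U \<le> W / 2\<close> by simp
    hence "c * sum w B < sum w (?b B)" using exp[of B] B4 BX by (simp add: W_def)
    \<comment> \<open>By symmetry of \<open>E\<close>, a point of \<open>U\<close> with a neighbour
      in \<open>B\<close> would put that neighbour into the boundary of \<open>U\<close>, which
      \<open>B\<close> avoids. Hence boundary points of \<open>B\<close> lie outside
      \<open>U\<close>, and so in its boundary.\<close>
    also have "sum w (?b B) \<le> sum w (?b U)"
      by (intro mono) (auto simp: B_def vertex_boundary_def dest: sym)
    finally have "c * sum w B < c / 8 * W" using bUW by simp
    moreover have "c * (W / 4) \<le> c * sum w B" using B4 c by (intro mult_left_mono) auto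
    ultimately have "c * W < 0" by simp
    thus False using c W by (simp add: W_def mult_less_0_iff)
  qed
  hence "vertex_expander (c / 8) E w Y"
    using X w YX by (auto simp: vertex_expander_def intro: finite_subset)
  thus ?thesis using that[of Y] YX WF F2 by (simp add: W_def)
qed

text \<open>The coarea formula: integrate the expansion inequality for the level sets \<open>{G > t}\<close> over
  \<open>t > 0\<close>.\<close>

lemma vertex_expander_coarea:
  fixes G :: "'a \<Rightarrow> real"
  assumes Y: "vertex_expander c E w Y" and G: "\<And>x. x \<in> Y \<Longrightarrow> 0 \<le> G x"
    and half: "sum w {x \<in> Y. 0 < G x} \<le> sum w Y / 2"
  shows "c * (\<Sum>x\<in>Y. w x * G x) \<le> (\<Sum>x\<in>Y. w x * (\<Sum>y | y \<in> Y \<and> E x y. max 0 (G y - G x)))"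
proof -
  have fin: "finite Y" and w: "\<And>x. x \<in> Y \<Longrightarrow> 0 \<le> w x"
    and exp: "\<And>A. A \<subseteq> Y \<Longrightarrow> sum w A \<le> sum w Y / 2 \<Longrightarrow>
      c * sum w A \<le> sum w (vertex_boundary E Y A)"
    using Y by (auto simp: vertex_expander_def)
  have I: "integrable lborel (indicator {a..<b} :: real \<Rightarrow> real)" for a b :: real
    by (cases "a \<le> b") (auto intro!: integrable_real_indicator)
  have V: "measure lborel {a..<b} = max 0 (b - a)" for a b :: real
    by (cases "a \<le> b") auto
  \<comment> \<open>For \<open>t \<ge> 0\<close> the integrand on the left sees the level set of
    points with \<open>t < G x\<close>, and the one on the right the edges along which
    \<open>G\<close> crosses \<open>t\<close>. The half-open intervals match the strict level sets;
    they are empty when \<open>G y \<le> G x\<close>, which produces the positive part after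
    integration.\<close>
  let ?L = "\<lambda>t. c * (\<Sum>x\<in>Y. w x * indicator {0..<G x} t)"
  let ?R = "\<lambda>t. \<Sum>x\<in>Y. w x * (\<Sum>y | y \<in> Y \<and> E x y. indicator {G x..<G y} t)"
  have "(LINT t|lborel. ?L t) \<le> (LINT t|lborel. ?R t)"
  proof (rule integral_mono)
    show "?L t \<le> ?R t" for t
    proof (cases "0 \<le> t")
      case True
      let ?A = "{x \<in> Y. t < G x}"
      have "(\<Sum>x\<in>Y. w x * indicator {0..<G x} t) = (\<Sum>x\<in>Y. if t < G x then w x else 0)"
        using True by (intro sum.cong) auto
      hence "(\<Sum>x\<in>Y. w x * indicator {0..<G x} t) = sum w ?A"
        using fin by (simp add: sum.inter_filter)
      moreover have "sum w ?A \<le> sum w {x \<in> Y. 0 < G x}"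
        using True fin w by (intro sum_mono2) auto
      ultimately have "?L t \<le> sum w (vertex_boundary E Y ?A)"
        using exp[of ?A] half by auto
      also have "\<dots> = (\<Sum>x\<in>Y. w x * indicator (vertex_boundary E Y ?A) x)"
        using fin by (intro sum.mono_neutral_cong_left) (auto simp: vertex_boundary_def)
      also have "\<dots> \<le> ?R t"
      proof (intro sum_mono mult_left_mono w)
        fix x assume x: "x \<in> Y"
        show "indicator (vertex_boundary E Y ?A) x
            \<le> (\<Sum>y | y \<in> Y \<and> E x y. indicator {G x..<G y} t :: real)"
        proof (cases "x \<in> vertex_boundary E Y ?A")
          case True
          then obtain y where y: "y \<in> Y" "t < G y" "E x y" "G x \<le> t"
            by (auto simp: vertex_boundary_def)
          thus ?thesis
            using True fin member_le_sum[of y "{y. y \<in> Y \<and> E x y}" "\<lambda>y. indicator {G x..<G y} t :: real"]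
            by simp
        qed (auto intro: sum_nonneg)
      qed
      finally show ?thesis .
    next
      case False
      hence "?L t = 0" by simp
      moreover have "0 \<le> ?R t" using w by (intro sum_nonneg mult_nonneg_nonneg) auto
      ultimately show ?thesis by linarith
    qed
  qed (use I in auto)
  moreover have "(LINT t|lborel. ?L t) = c * (\<Sum>x\<in>Y. w x * G x)"
    using I G by (simp add: V max_def)
  moreover have "(LINT t|lborel. ?R t) = (\<Sum>x\<in>Y. w x * (\<Sum>y | y \<in> Y \<and> E x y. max 0 (G y - G x)))"
    using I by (simp add: V)
  ultimately show ?thesis by linarith
qed

section \<open>Poincare inequalities for scalar functions\<close>

text \<open>Take \<open>t\<close> to be the least value of \<open>g\<close> whose strict superlevel
  set has at most half the weight. If \<open>s\<close> is the value preceding it, the superlevel set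
  of \<open>s\<close> has more than half the weight, and its complement is exactly the set where
  \<open>g x < t\<close>.\<close>

lemma weighted_median:
  fixes w g :: "'a \<Rightarrow> real"
  assumes fin: "finite Y" and w: "\<And>x. x \<in> Y \<Longrightarrow> 0 \<le> w x"
  obtains t where "sum w {x \<in> Y. t < g x} \<le> sum w Y / 2" "sum w {x \<in> Y. g x < t} \<le> sum w Y / 2"
proof (cases "Y = {}")
  case False
  have pos: "0 \<le> sum w Y" using w by (intro sum_nonneg) auto
  define T where "T = {s \<in> g ` Y. sum w {x \<in> Y. s < g x} \<le> sum w Y / 2}"
  have "Max (g ` Y) \<in> T"
  proof -
    have "{x \<in> Y. Max (g ` Y) < g x} = {}" using fin by (auto simp: not_less)
    hence "sum w {x \<in> Y. Max (g ` Y) < g x} = 0" by (metis sum.empty)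
    thus ?thesis using fin False pos by (simp add: T_def)
  qed
  moreover have "finite T" using fin by (simp add: T_def)
  ultimately have t: "Min T \<in> T" "\<And>s. s \<in> T \<Longrightarrow> Min T \<le> s" by (auto intro: Min_in)
  define t where "t = Min T"
  have "sum w {x \<in> Y. g x < t} \<le> sum w Y / 2"
  proof (cases "{x \<in> Y. g x < t} = {}")
    case True
    then show ?thesis using pos by (metis sum.empty divide_nonneg_nonneg zero_le_numeral)
  next
    case ne: False
    define s where "s = Max (g ` {x \<in> Y. g x < t})"
    have s: "s \<in> g ` {x \<in> Y. g x < t}"
      unfolding s_def using ne fin by (intro Max_in) auto
    have smax: "g x \<le> s" if "x \<in> Y" "g x < t" for x
      unfolding s_def using that fin by (intro Max_ge) auto
    have "s \<notin> T" using s t(2)[of s] by (auto simp: t_def)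
    hence "sum w Y / 2 < sum w {x \<in> Y. s < g x}" using s by (auto simp: T_def)
    moreover have "sum w Y = sum w {x \<in> Y. s < g x} + sum w {x \<in> Y. g x < t}"
    proof -
      have "Y = {x \<in> Y. s < g x} \<union> {x \<in> Y. g x < t}" using s by auto
      moreover have "{x \<in> Y. s < g x} \<inter> {x \<in> Y. g x < t} = {}" using smax by force
      ultimately show ?thesis using fin by (metis (lifting) finite_Un sum.union_disjoint)
    qed
    ultimately show ?thesis by simp
  qed
  moreover have "sum w {x \<in> Y. t < g x} \<le> sum w Y / 2" using t(1) by (auto simp: T_def t_def)
  ultimately show ?thesis using that by blast
qed (use that in simp)

text \<open>The coarea inequality is applied to the \<open>p\<close>-th power \<open>G\<close> of
  the positive part of \<open>g\<close>. Its increments are at most \<open>e * G x\<close> plus a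
  multiple of the wanted difference; summed over at most \<open>K\<close> neighbours, the first term
  is absorbed by the left-hand side. The constant is fixed before the graph, so it is uniform over a
  whole sequence of expanders.\<close>

lemma vertex_expander_poincare_pos:
  fixes p c :: real and K :: nat
  assumes p: "0 < p" and c: "0 < c"
  obtains C where "0 \<le> C"
    "\<And>(E :: 'a \<Rightarrow> 'a \<Rightarrow> bool) w Y g. vertex_expander c E w Y \<Longrightarrow>
      (\<And>x. x \<in> Y \<Longrightarrow> card {y. y \<in> Y \<and> E x y} \<le> K) \<Longrightarrow>
      sum w {x \<in> Y. 0 < g x} \<le> sum w Y / 2 \<Longrightarrow>
      (\<Sum>x\<in>Y. w x * max 0 (g x) powr p)
        \<le> C * (\<Sum>x\<in>Y. w x * (\<Sum>y | y \<in> Y \<and> E x y. \<bar>g y - g x\<bar> powr p))"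
proof -
  \<comment> \<open>Chosen so that \<open>K\<close> neighbours use up only half of the expansion
    constant; adding 1 covers \<open>K = 0\<close>.\<close>
  define e where "e = c / (2 * (real K + 1))"
  have e: "0 < e" and Ke: "real K * e \<le> c / 2"
    using c by (auto simp: e_def field_simps)
  obtain C where C: "0 \<le> C"
    "\<And>a b. 0 \<le> a \<Longrightarrow> 0 \<le> b \<Longrightarrow> (a + b) powr p \<le> (1 + e) * a powr p + C * b powr p"
    using powr_add_le_weighted[OF p e] by blast
  have "(\<Sum>x\<in>Y. w x * max 0 (g x) powr p)
        \<le> 2 * C / c * (\<Sum>x\<in>Y. w x * (\<Sum>y | y \<in> Y \<and> E x y. \<bar>g y - g x\<bar> powr p))"
    if Y: "vertex_expander c E w Y" and K: "\<And>x. x \<in> Y \<Longrightarrow> card {y. y \<in> Y \<and> E x y} \<le> K"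
      and half: "sum w {x \<in> Y. 0 < g x} \<le> sum w Y / 2"
    for E :: "'a \<Rightarrow> 'a \<Rightarrow> bool" and w Y g
  proof -
    have w: "\<And>x. x \<in> Y \<Longrightarrow> 0 \<le> w x" using Y by (simp add: vertex_expander_def)
    define G where "G x = max 0 (g x) powr p" for x
    have G0: "0 \<le> G x" for x by (simp add: G_def)
    let ?D = "\<lambda>x. \<Sum>y | y \<in> Y \<and> E x y. \<bar>g y - g x\<bar> powr p"
    have Gd: "max 0 (G y - G x) \<le> e * G x + C * \<bar>g y - g x\<bar> powr p" for x y
    proof -
      have "G y \<le> (max 0 (g x) + \<bar>g y - g x\<bar>) powr p"
        unfolding G_def using p by (intro powr_mono2) auto
      also have "\<dots> \<le> (1 + e) * G x + C * \<bar>g y - g x\<bar> powr p"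
        unfolding G_def by (rule C) auto
      finally show ?thesis using e C(1) G0[of x] by (simp add: algebra_simps)
    qed
    have pw: "(\<Sum>y | y \<in> Y \<and> E x y. max 0 (G y - G x)) \<le> c / 2 * G x + C * ?D x" if "x \<in> Y" for x
    proof -
      have "(\<Sum>y | y \<in> Y \<and> E x y. max 0 (G y - G x))
          \<le> (\<Sum>y | y \<in> Y \<and> E x y. e * G x + C * \<bar>g y - g x\<bar> powr p)"
        by (intro sum_mono Gd)
      also have "\<dots> = real (card {y. y \<in> Y \<and> E x y}) * (e * G x) + C * ?D x"
        by (simp add: sum.distrib sum_distrib_left)
      also have "real (card {y. y \<in> Y \<and> E x y}) * (e * G x) \<le> real K * (e * G x)"
        using K[OF that] e G0[of x] by (intro mult_right_mono) auto
      also have "real K * (e * G x) \<le> c / 2 * G x"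
        using mult_right_mono[OF Ke G0[of x]] by (simp add: mult.assoc)
      finally show ?thesis by simp
    qed
    have "{x \<in> Y. 0 < G x} = {x \<in> Y. 0 < g x}" by (auto simp: G_def)
    with half have "c * (\<Sum>x\<in>Y. w x * G x)
        \<le> (\<Sum>x\<in>Y. w x * (\<Sum>y | y \<in> Y \<and> E x y. max 0 (G y - G x)))"
      by (intro vertex_expander_coarea[OF Y]) (auto simp: G0)
    also have "\<dots> \<le> (\<Sum>x\<in>Y. w x * (c / 2 * G x + C * ?D x))"
      by (intro sum_mono mult_left_mono pw w)
    also have "\<dots> = c / 2 * (\<Sum>x\<in>Y. w x * G x) + C * (\<Sum>x\<in>Y. w x * ?D x)"
      by (simp add: sum_distrib_left sum.distrib algebra_simps)
    finally have "c / 2 * (\<Sum>x\<in>Y. w x * G x) \<le> C * (\<Sum>x\<in>Y. w x * ?D x)" by simp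
    thus ?thesis using c by (simp add: G_def field_simps)
  qed
  thus ?thesis using that[of "2 * C / c"] c C(1) by simp
qed

text \<open>Around a median \<open>t\<close>, both \<open>g - t\<close> and \<open>t - g\<close> are
  positive on at most half of the weight, so the one-sided inequality bounds the deviation from
  \<open>t\<close>. The triangle inequality through \<open>t\<close> passes to pairs. The factor 4
  counts two signs and two variables.\<close>

lemma vertex_expander_poincare_real:
  fixes p c :: real and K :: nat
  assumes p: "0 < p" and c: "0 < c"
  obtains C where "0 \<le> C"
    "\<And>(E :: 'a \<Rightarrow> 'a \<Rightarrow> bool) w Y g. vertex_expander c E w Y \<Longrightarrow>
      (\<And>x. x \<in> Y \<Longrightarrow> card {y. y \<in> Y \<and> E x y} \<le> K) \<Longrightarrow>
      (\<Sum>x\<in>Y. \<Sum>y\<in>Y. w x * w y * \<bar>g y - g x\<bar> powr p)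
        \<le> C * sum w Y * (\<Sum>x\<in>Y. w x * (\<Sum>y | y \<in> Y \<and> E x y. \<bar>g y - g x\<bar> powr p))"
proof -
  obtain C where C: "0 \<le> C"
    "\<And>(E :: 'a \<Rightarrow> 'a \<Rightarrow> bool) w Y g. vertex_expander c E w Y \<Longrightarrow>
      (\<And>x. x \<in> Y \<Longrightarrow> card {y. y \<in> Y \<and> E x y} \<le> K) \<Longrightarrow>
      sum w {x \<in> Y. 0 < g x} \<le> sum w Y / 2 \<Longrightarrow>
      (\<Sum>x\<in>Y. w x * max 0 (g x) powr p)
        \<le> C * (\<Sum>x\<in>Y. w x * (\<Sum>y | y \<in> Y \<and> E x y. \<bar>g y - g x\<bar> powr p))"
    using vertex_expander_poincare_pos[OF p c, of K] by blast
  have "(\<Sum>x\<in>Y. \<Sum>y\<in>Y. w x * w y * \<bar>g y - g x\<bar> powr p)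
        \<le> 4 * 2 powr p * C * sum w Y *
          (\<Sum>x\<in>Y. w x * (\<Sum>y | y \<in> Y \<and> E x y. \<bar>g y - g x\<bar> powr p))"
    if Y: "vertex_expander c E w Y" and K: "\<And>x. x \<in> Y \<Longrightarrow> card {y. y \<in> Y \<and> E x y} \<le> K"
    for E :: "'a \<Rightarrow> 'a \<Rightarrow> bool" and w Y g
  proof -
    have fin: "finite Y" and w: "\<And>x. x \<in> Y \<Longrightarrow> 0 \<le> w x"
      using Y by (auto simp: vertex_expander_def)
    define B where "B = (\<Sum>x\<in>Y. w x * (\<Sum>y | y \<in> Y \<and> E x y. \<bar>g y - g x\<bar> powr p))"
    obtain t where t: "sum w {x \<in> Y. t < g x} \<le> sum w Y / 2" "sum w {x \<in> Y. g x < t} \<le> sum w Y / 2"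
      by (rule weighted_median[of Y w g]) (use fin w in auto)
    define S where "S = (\<Sum>x\<in>Y. w x * \<bar>g x - t\<bar> powr p)"
    have "S = (\<Sum>x\<in>Y. w x * max 0 (g x - t) powr p) + (\<Sum>x\<in>Y. w x * max 0 (t - g x) powr p)"
      unfolding S_def sum.distrib[symmetric] by (intro sum.cong) (auto simp: max_def abs_if)
    moreover have "(\<Sum>x\<in>Y. w x * max 0 (g x - t) powr p) \<le> C * B"
      using C(2)[OF Y K, of "\<lambda>x. g x - t"] t by (simp add: B_def)
    moreover have "(\<Sum>x\<in>Y. w x * max 0 (t - g x) powr p) \<le> C * B"
      using C(2)[OF Y K, of "\<lambda>x. t - g x"] t by (simp add: B_def abs_minus_commute)
    ultimately have S: "S \<le> 2 * (C * B)" by simp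
    have "(\<Sum>x\<in>Y. \<Sum>y\<in>Y. w x * w y * \<bar>g y - g x\<bar> powr p)
        \<le> (\<Sum>x\<in>Y. \<Sum>y\<in>Y. w x * w y * (2 powr p * (\<bar>g y - t\<bar> powr p + \<bar>g x - t\<bar> powr p)))"
    proof (intro sum_mono mult_left_mono mult_nonneg_nonneg w)
      fix x y
      have "\<bar>g y - g x\<bar> powr p \<le> (\<bar>g y - t\<bar> + \<bar>g x - t\<bar>) powr p"
        using p by (intro powr_mono2) auto
      also have "\<dots> \<le> 2 powr p * (\<bar>g y - t\<bar> powr p + \<bar>g x - t\<bar> powr p)"
        using p by (intro powr_add_le) auto
      finally show "\<bar>g y - g x\<bar> powr p \<le> 2 powr p * (\<bar>g y - t\<bar> powr p + \<bar>g x - t\<bar> powr p)" .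
    qed auto
    also have "\<dots> = 2 powr p * ((\<Sum>x\<in>Y. \<Sum>y\<in>Y. w x * (w y * \<bar>g y - t\<bar> powr p))
        + (\<Sum>x\<in>Y. \<Sum>y\<in>Y. (w x * \<bar>g x - t\<bar> powr p) * w y))"
      unfolding sum_distrib_left sum.distrib[symmetric] by (intro sum.cong) (auto simp: algebra_simps)
    also have "\<dots> = 2 powr p * (2 * (sum w Y * S))"
      by (simp add: S_def sum_product[symmetric])
    also have "\<dots> \<le> 2 powr p * (2 * (sum w Y * (2 * (C * B))))"
      using S w by (intro mult_left_mono) (auto intro: sum_nonneg)
    finally show ?thesis by (simp add: B_def mult.assoc mult.left_commute)
  qed
  thus ?thesis using that[of "4 * 2 powr p * C"] C(1) by simp
qed

section \<open>Poincare inequalities for vector-valued and L^p-valued maps\<close>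

text \<open>Apply the scalar inequality to each coordinate. Bounding the norm by the sum of the
  coordinates costs \<open>N powr p\<close>, and bounding each coordinate by the norm on the right
  costs the number \<open>N\<close> of coordinates.\<close>

lemma vertex_expander_poincare:
  fixes p c :: real and K :: nat
  assumes p: "0 < p" and c: "0 < c"
  obtains C where "0 \<le> C"
    "\<And>(E :: 'a \<Rightarrow> 'a \<Rightarrow> bool) w Y (h :: 'a \<Rightarrow> 'k :: euclidean_space). vertex_expander c E w Y \<Longrightarrow>
      (\<And>x. x \<in> Y \<Longrightarrow> card {y. y \<in> Y \<and> E x y} \<le> K) \<Longrightarrow>
      (\<Sum>x\<in>Y. \<Sum>y\<in>Y. w x * w y * norm (h y - h x) powr p)
        \<le> C * sum w Y * (\<Sum>x\<in>Y. w x * (\<Sum>y | y \<in> Y \<and> E x y. norm (h y - h x) powr p))"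
proof -
  obtain C where C: "0 \<le> C"
    "\<And>(E :: 'a \<Rightarrow> 'a \<Rightarrow> bool) w Y g. vertex_expander c E w Y \<Longrightarrow>
      (\<And>x. x \<in> Y \<Longrightarrow> card {y. y \<in> Y \<and> E x y} \<le> K) \<Longrightarrow>
      (\<Sum>x\<in>Y. \<Sum>y\<in>Y. w x * w y * \<bar>g y - g x\<bar> powr p)
        \<le> C * sum w Y * (\<Sum>x\<in>Y. w x * (\<Sum>y | y \<in> Y \<and> E x y. \<bar>g y - g x\<bar> powr p))"
    using vertex_expander_poincare_real[OF p c, of K] by blast
  define N where "N = real DIM('k)"
  have "(\<Sum>x\<in>Y. \<Sum>y\<in>Y. w x * w y * norm (h y - h x) powr p)
        \<le> N powr p * N * C * sum w Y * (\<Sum>x\<in>Y. w x * (\<Sum>y | y \<in> Y \<and> E x y. norm (h y - h x) powr p))"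
    if Y: "vertex_expander c E w Y" and K: "\<And>x. x \<in> Y \<Longrightarrow> card {y. y \<in> Y \<and> E x y} \<le> K"
    for E :: "'a \<Rightarrow> 'a \<Rightarrow> bool" and w Y and h :: "'a \<Rightarrow> 'k"
  proof -
    have w: "\<And>x. x \<in> Y \<Longrightarrow> 0 \<le> w x" using Y by (auto simp: vertex_expander_def)
    have W: "0 \<le> sum w Y" using w by (intro sum_nonneg)
    let ?B = "\<Sum>x\<in>Y. w x * (\<Sum>y | y \<in> Y \<and> E x y. norm (h y - h x) powr p)"
    have "(\<Sum>x\<in>Y. \<Sum>y\<in>Y. w x * w y * norm (h y - h x) powr p)
        \<le> (\<Sum>x\<in>Y. \<Sum>y\<in>Y. w x * w y * (N powr p * (\<Sum>b\<in>Basis. \<bar>h y \<bullet> b - h x \<bullet> b\<bar> powr p)))"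
    proof (intro sum_mono mult_left_mono mult_nonneg_nonneg w)
      fix x y
      have "norm (h y - h x) powr p \<le> (\<Sum>b\<in>Basis. \<bar>(h y - h x) \<bullet> b\<bar>) powr p"
        using p by (intro powr_mono2 norm_le_l1) auto
      also have "\<dots> \<le> N powr p * (\<Sum>b\<in>Basis. \<bar>(h y - h x) \<bullet> b\<bar> powr p)"
        unfolding N_def using p by (intro powr_sum_le) auto
      finally show "norm (h y - h x) powr p \<le> N powr p * (\<Sum>b\<in>Basis. \<bar>h y \<bullet> b - h x \<bullet> b\<bar> powr p)"
        by (simp add: inner_diff_left)
    qed auto
    also have "\<dots> = N powr p * (\<Sum>x\<in>Y. \<Sum>y\<in>Y. \<Sum>b\<in>Basis. w x * w y * \<bar>h y \<bullet> b - h x \<bullet> b\<bar> powr p)"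
      by (simp add: sum_distrib_left mult_ac)
    also have "(\<Sum>x\<in>Y. \<Sum>y\<in>Y. \<Sum>b\<in>Basis. w x * w y * \<bar>h y \<bullet> b - h x \<bullet> b\<bar> powr p)
        = (\<Sum>b\<in>Basis. \<Sum>x\<in>Y. \<Sum>y\<in>Y. w x * w y * \<bar>h y \<bullet> b - h x \<bullet> b\<bar> powr p)"
      by (simp add: sum.swap[of _ Basis])
    also have "\<dots> \<le> (\<Sum>b\<in>(Basis :: 'k set). C * sum w Y * ?B)"
    proof (intro sum_mono)
      fix b :: 'k assume b: "b \<in> Basis"
      have "(\<Sum>x\<in>Y. \<Sum>y\<in>Y. w x * w y * \<bar>h y \<bullet> b - h x \<bullet> b\<bar> powr p)
          \<le> C * sum w Y * (\<Sum>x\<in>Y. w x * (\<Sum>y | y \<in> Y \<and> E x y. \<bar>h y \<bullet> b - h x \<bullet> b\<bar> powr p))"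
        using C(2)[OF Y K] .
      also have "\<dots> \<le> C * sum w Y * ?B"
        using b p C(1) W Basis_le_norm[OF b]
        by (intro mult_left_mono sum_mono powr_mono2 w mult_nonneg_nonneg)
          (auto simp: inner_diff_left[symmetric])
      finally show "(\<Sum>x\<in>Y. \<Sum>y\<in>Y. w x * w y * \<bar>h y \<bullet> b - h x \<bullet> b\<bar> powr p) \<le> C * sum w Y * ?B" .
    qed
    also have "\<dots> = N * (C * sum w Y * ?B)" by (simp add: N_def)
    finally show ?thesis by (simp add: mult.assoc mult_left_mono)
  qed
  thus ?thesis using that[of "N powr p * N * C"] C(1) by (simp add: N_def)
qed

lemma Lp_space_some:
  assumes "F \<in> Lp_space p M"
  shows "(SOME f. f \<in> F) \<in> Lp_functions p M"
proof -
  have "F \<noteq> {}" "F \<subseteq> Lp_functions p M"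
    using assms in_quotient_imp_non_empty[OF equiv_Lp_rel] in_quotient_imp_subset[OF equiv_Lp_rel]
    unfolding Lp_space_def by blast+
  thus ?thesis by (metis some_in_eq subsetD)
qed

text \<open>A non-integrable function has Bochner integral 0, so integrability has to be known
  before the pointwise Poincare inequality is integrated.\<close>

lemma Lp_functions_diff:
  fixes f g :: "'z \<Rightarrow> 'k :: {real_normed_field, euclidean_space}"
  assumes p: "0 \<le> p" and f: "f \<in> Lp_functions p M" and g: "g \<in> Lp_functions p M"
  shows "integrable M (\<lambda>z. norm (f z - g z) powr p)"
proof (rule Bochner_Integration.integrable_bound)
  show "integrable M (\<lambda>z. 2 powr p * (norm (f z) powr p + norm (g z) powr p))"
    using f g by (auto simp: Lp_functions_def)
  show "(\<lambda>z. norm (f z - g z) powr p) \<in> borel_measurable M"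
    using f g by (auto simp: Lp_functions_def)
  have "norm (f z - g z) powr p \<le> 2 powr p * (norm (f z) powr p + norm (g z) powr p)" for z
  proof -
    have "norm (f z - g z) powr p \<le> (norm (f z) + norm (g z)) powr p"
      using p by (intro powr_mono2 norm_triangle_ineq4) auto
    also have "\<dots> \<le> 2 powr p * (norm (f z) powr p + norm (g z) powr p)"
      using p by (intro powr_add_le) auto
    finally show ?thesis .
  qed
  thus "AE z in M. norm (norm (f z - g z) powr p)
      \<le> norm (2 powr p * (norm (f z) powr p + norm (g z) powr p))"
    by (intro AE_I2) (auto intro: order_trans[OF _ abs_ge_self])
qed

text \<open>The \<open>p\<close>-th power of the distance is an integral over the base, and both
  sides are linear in such powers. It therefore suffices to integrate the pointwise inequality.
  Taking the representatives that \<open>Lp_dist\<close> itself chooses avoids any argument about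
  null sets.\<close>

lemma vertex_expander_poincare_Lp:
  fixes p c :: real and K :: nat and M :: "'z measure"
  assumes p: "0 < p" and c: "0 < c"
  obtains C where "0 \<le> C"
    "\<And>(E :: 'a \<Rightarrow> 'a \<Rightarrow> bool) w Y
        (F :: 'a \<Rightarrow> ('z \<Rightarrow> 'k :: {real_normed_field, euclidean_space}) set). vertex_expander c E w Y \<Longrightarrow>
      (\<And>x. x \<in> Y \<Longrightarrow> card {y. y \<in> Y \<and> E x y} \<le> K) \<Longrightarrow>
      (\<And>x. x \<in> Y \<Longrightarrow> F x \<in> Lp_space p M) \<Longrightarrow>
      (\<Sum>x\<in>Y. \<Sum>y\<in>Y. w x * w y * Lp_dist p M (F y) (F x) powr p)
        \<le> C * sum w Y * (\<Sum>x\<in>Y. w x * (\<Sum>y | y \<in> Y \<and> E x y. Lp_dist p M (F y) (F x) powr p))"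
proof -
  obtain C where C: "0 \<le> C"
    "\<And>(E :: 'a \<Rightarrow> 'a \<Rightarrow> bool) w Y (h :: 'a \<Rightarrow> 'k). vertex_expander c E w Y \<Longrightarrow>
      (\<And>x. x \<in> Y \<Longrightarrow> card {y. y \<in> Y \<and> E x y} \<le> K) \<Longrightarrow>
      (\<Sum>x\<in>Y. \<Sum>y\<in>Y. w x * w y * norm (h y - h x) powr p)
        \<le> C * sum w Y * (\<Sum>x\<in>Y. w x * (\<Sum>y | y \<in> Y \<and> E x y. norm (h y - h x) powr p))"
    using vertex_expander_poincare[OF p c, of K] by blast
  have "(\<Sum>x\<in>Y. \<Sum>y\<in>Y. w x * w y * Lp_dist p M (F y) (F x) powr p)
        \<le> C * sum w Y * (\<Sum>x\<in>Y. w x * (\<Sum>y | y \<in> Y \<and> E x y. Lp_dist p M (F y) (F x) powr p))"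
    if Y: "vertex_expander c E w Y" and K: "\<And>x. x \<in> Y \<Longrightarrow> card {y. y \<in> Y \<and> E x y} \<le> K"
      and F: "\<And>x. x \<in> Y \<Longrightarrow> F x \<in> Lp_space p M"
    for E :: "'a \<Rightarrow> 'a \<Rightarrow> bool" and w Y and F :: "'a \<Rightarrow> ('z \<Rightarrow> 'k) set"
  proof -
    define h where "h x = (SOME f. f \<in> F x)" for x
    have int: "integrable M (\<lambda>z. norm (h y z - h x z) powr p)" if "x \<in> Y" "y \<in> Y" for x y
      unfolding h_def using p that by (intro Lp_functions_diff Lp_space_some F) auto
    have Lp: "Lp_dist p M (F y) (F x) powr p = (LINT z|M. norm (h y z - h x z) powr p)" for x y
      using p unfolding Lp_dist_def h_def[symmetric] by (simp add: powr_powr)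
    have "(LINT z|M. (\<Sum>x\<in>Y. \<Sum>y\<in>Y. w x * w y * norm (h y z - h x z) powr p))
      \<le> (LINT z|M. C * sum w Y * (\<Sum>x\<in>Y. w x * (\<Sum>y | y \<in> Y \<and> E x y. norm (h y z - h x z) powr p)))"
      using int C(2)[OF Y K, of "\<lambda>x. h x z" for z] by (intro integral_mono) (auto intro!: Bochner_Integration.integrable_sum integrable_mult_right)
    also have "\<dots> = C * sum w Y *
        (\<Sum>x\<in>Y. LINT z|M. w x * (\<Sum>y | y \<in> Y \<and> E x y. norm (h y z - h x z) powr p))"
      using int by (subst integral_mult_right_zero, subst Bochner_Integration.integral_sum)
        (auto intro!: Bochner_Integration.integrable_sum integrable_mult_right)
    finally show ?thesis using int by (simp add: Lp)
  qed
  thus ?thesis using that[of C] C(1) by simp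
qed

section \<open>Ghostly asymptotic expanders\<close>

text \<open>The infimum over a finite non-empty set is attained. For empty \<open>A\<close> it is
  infinite, and both sides are false.\<close>

lemma set_dist_singleton_le_iff:
  assumes "finite A"
  shows "set_dist d {x} A \<le> ereal r \<longleftrightarrow> (\<exists>a\<in>A. d x a \<le> r)"
proof (cases "A = {}")
  case False
  have "set_dist d {x} A = Min ((\<lambda>a. ereal (d x a)) ` A)"
    using assms False by (simp add: set_dist_def cInf_eq_Min)
  thus ?thesis using assms False by (simp add: Min_le_iff)
qed (simp add: set_dist_def top_ereal_def)

lemma outer_boundary_eq_vertex_boundary:
  assumes "finite X" "A \<subseteq> X"
  shows "outer_boundary X d R A = vertex_boundary (\<lambda>x y. x \<in> X \<and> y \<in> X \<and> d x y \<le> R) X A"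
  using assms finite_subset[OF assms(2,1)]
  by (auto simp: outer_boundary_def vertex_boundary_def set_dist_singleton_le_iff)

theorem corollary7p2:
  fixes X :: "nat \<Rightarrow> 'a set"
    and \<delta> :: "nat \<Rightarrow> 'a \<Rightarrow> 'a \<Rightarrow> real"
    and m :: "nat \<Rightarrow> 'a measure"
    and d :: "nat \<times> 'a \<Rightarrow> nat \<times> 'a \<Rightarrow> real"
    and p :: real
    and M :: "'z measure"
  assumes "measured_asymptotic_expanders X \<delta> m"
    and "ghostly X m"
    and "uniformly_bounded_geometry X \<delta>"
    and "coarse_disjoint_union X \<delta> d"
    and "1 \<le> p"
  shows "\<not> (\<exists>f. coarse_embedding (Sigma UNIV X) d
                 (Lp_space p M :: ('z \<Rightarrow> 'k::{real_normed_field, euclidean_space}) set set)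
                 (Lp_dist p M) f)"
proof
  assume "\<exists>f. coarse_embedding (Sigma UNIV X) d
                 (Lp_space p M :: ('z \<Rightarrow> 'k) set set) (Lp_dist p M) f"
  then obtain f :: "nat \<times> 'a \<Rightarrow> ('z \<Rightarrow> 'k) set" and \<rho>\<^sub>1 \<rho>\<^sub>2 where
    f: "f \<in> Sigma UNIV X \<rightarrow> Lp_space p M"
    and cf: "control_function \<rho>\<^sub>1" "control_function \<rho>\<^sub>2"
    and lower: "\<And>u v. u \<in> Sigma UNIV X \<Longrightarrow> v \<in> Sigma UNIV X \<Longrightarrow> \<rho>\<^sub>1 (d u v) \<le> Lp_dist p M (f u) (f v)"
    and upper: "\<And>u v. u \<in> Sigma UNIV X \<Longrightarrow> v \<in> Sigma UNIV X \<Longrightarrow> Lp_dist p M (f u) (f v) \<le> \<rho>\<^sub>2 (d u v)"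
    unfolding coarse_embedding_def by blast
  have d_eq: "d (n, x) (n, y) = \<delta> n x y" if "x \<in> X n" "y \<in> X n" for n x y
    using assms(4) that by (simp add: coarse_disjoint_union_def)
  have fmms: "finite_measured_metric_space (X n) (\<delta> n) (m n)" for n
    using assms(1) by (simp add: measured_asymptotic_expanders_def)
  hence met: "Metric_space (X n) (\<delta> n)" and fin: "finite (X n)" for n
    by (auto simp: finite_measured_metric_space_def)
  have dn: "0 \<le> \<delta> n x y" for n x y using Metric_space.nonneg[OF met] .
  have ball: "{y. y \<in> X n \<and> \<delta> n x y \<le> r} = Metric_space.mcball (X n) (\<delta> n) x r"
    if "x \<in> X n" for n x r
    using that by (auto simp: Metric_space.mcball_def[OF met])
  define w where "w n x = measure (m n) {x}" for n x
  have w0: "0 \<le> w n x" for n x by (simp add: w_def)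
  have msum: "measure (m n) A = sum (w n) A" if "A \<subseteq> X n" for n A
    using fmms[of n] that finite_subset[OF that fin]
    by (auto simp: w_def finite_measured_metric_space_def
        intro!: finite_measure.finite_measure_eq_sum_singleton)
  have W0: "0 < sum (w n) (X n)" for n
  proof -
    have "sum (w n) (X n) \<noteq> 0"
      using fmms[of n] msum[of "X n" n] by (simp add: finite_measured_metric_space_def)
    thus ?thesis using sum_nonneg[of "X n" "w n"] w0 by fastforce
  qed
  \<comment> \<open>The parameter 1/4 gives the range of weights demanded by
    \<open>vertex_expander_subset\<close>.\<close>
  have "\<exists>c R. 0 < c \<and> c < 1 \<and> 0 < R \<and>
           (\<forall>n. \<forall>A\<subseteq>X n.
              1/4 * measure (m n) (X n) \<le> measure (m n) A \<and>
              measure (m n) A \<le> 1/2 * measure (m n) (X n) \<longrightarrow>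
              measure (m n) (outer_boundary (X n) (\<delta> n) R A) > c * measure (m n) A)"
    using assms(1) unfolding measured_asymptotic_expanders_def
    by (elim conjE allE[of _ "1/4 :: real"]) simp
  then obtain c R where c: "0 < c" "c < 1" and R: "0 < R" and
    exp: "\<And>n A. A \<subseteq> X n \<Longrightarrow> 1/4 * measure (m n) (X n) \<le> measure (m n) A \<Longrightarrow>
      measure (m n) A \<le> 1/2 * measure (m n) (X n) \<Longrightarrow>
      measure (m n) (outer_boundary (X n) (\<delta> n) R A) > c * measure (m n) A"
    by blast
  obtain K where K: "\<And>n x. x \<in> X n \<Longrightarrow> card {y. y \<in> X n \<and> \<delta> n x y \<le> R} \<le> K"
    using assms(3) R ball unfolding uniformly_bounded_geometry_def by metis
  have p: "0 < p" and c8: "0 < c / 8" using assms(5) c by auto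
  obtain C where C: "0 \<le> C"
    "\<And>(E :: 'a \<Rightarrow> 'a \<Rightarrow> bool) w Y (F :: 'a \<Rightarrow> ('z \<Rightarrow> 'k) set). vertex_expander (c / 8) E w Y \<Longrightarrow>
      (\<And>x. x \<in> Y \<Longrightarrow> card {y. y \<in> Y \<and> E x y} \<le> K) \<Longrightarrow>
      (\<And>x. x \<in> Y \<Longrightarrow> F x \<in> Lp_space p M) \<Longrightarrow>
      (\<Sum>x\<in>Y. \<Sum>y\<in>Y. w x * w y * Lp_dist p M (F y) (F x) powr p)
        \<le> C * sum w Y * (\<Sum>x\<in>Y. w x * (\<Sum>y | y \<in> Y \<and> E x y. Lp_dist p M (F y) (F x) powr p))"
    using vertex_expander_poincare_Lp[OF p c8, of K M] by blast
  \<comment> \<open>\<open>B\<close> will bound the mean of \<open>D\<close> over pairs from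
    \<open>Y\<close>: each point has at most \<open>K\<close> neighbours, at distance at most
    \<open>R\<close>. It is fixed before \<open>n\<close>, so the choices of \<open>S\<close>,
    \<open>L\<close> and \<open>q\<close> may depend on it.\<close>
  define B where "B = C * (real K * \<rho>\<^sub>2 R powr p)"
  have B0: "0 \<le> B" using C(1) by (simp add: B_def)
  \<comment> \<open>The threshold is such that three quarters of it exceed \<open>B\<close>, and it
    is at least 1, so that raising a larger number to the power \<open>p\<close> does not decrease
    it.\<close>
  obtain s where s: "0 \<le> s" "2 * B + 1 \<le> \<rho>\<^sub>1 s"
    using cf(1) unfolding control_function_def bdd_above_def
    by (metis atLeast_iff imageE linorder_le_cases)
  \<comment> \<open>Bounded geometry speaks of positive radii only, and \<open>s\<close> may be
    0.\<close>
  define S where "S = s + 1"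
  have S: "0 < S" using s by (simp add: S_def)
  have far: "2 * B + 1 \<le> \<rho>\<^sub>1 r" if "S < r" for r
    using s(2) monotone_onD[of "{0..}" "(\<le>)" "(\<le>)" \<rho>\<^sub>1 s r] cf(1) s(1) that
    by (auto simp: control_function_def S_def)
  obtain L where L: "\<And>n x. x \<in> X n \<Longrightarrow> card {y. y \<in> X n \<and> \<delta> n x y \<le> S} \<le> L"
    using assms(3) S ball unfolding uniformly_bounded_geometry_def by metis
  \<comment> \<open>If every point has at most the proportion \<open>q\<close> of the weight, a ball
    with at most \<open>L\<close> points has at most 1/8 of it, which is at most a quarter of the
    weight of \<open>Y\<close>.\<close>
  define q where "q = 1 / (8 * (real L + 1))"
  have q: "0 < q" by (simp add: q_def)
  have "\<forall>\<^sub>F n in sequentially. (SUP x\<in>X n. measure (m n) {x} / measure (m n) (X n)) < q"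
    using order_tendstoD(2)[OF assms(2)[unfolded ghostly_def] q] .
  then obtain n where n: "(SUP x\<in>X n. measure (m n) {x} / measure (m n) (X n)) < q"
    using eventually_happens'[OF sequentially_bot] by blast
  have wq: "w n x \<le> q * sum (w n) (X n)" if "x \<in> X n" for x
  proof -
    have "w n x / sum (w n) (X n) \<le> (SUP x\<in>X n. measure (m n) {x} / measure (m n) (X n))"
      using that fin by (simp add: w_def[symmetric] msum[symmetric]) (auto intro!: cSUP_upper)
    hence "w n x / sum (w n) (X n) \<le> q" using n by simp
    thus ?thesis using W0[of n] by (simp add: pos_divide_le_eq)
  qed
  let ?E = "\<lambda>x y. x \<in> X n \<and> y \<in> X n \<and> \<delta> n x y \<le> R"
  obtain Y where Y: "Y \<subseteq> X n" "sum (w n) (X n) / 2 \<le> sum (w n) Y"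
    "vertex_expander (c / 8) ?E (w n) Y"
  proof (rule vertex_expander_subset[of "X n" "w n" ?E c])
    show "c * sum (w n) A < sum (w n) (vertex_boundary ?E (X n) A)"
      if "A \<subseteq> X n" "sum (w n) (X n) / 4 \<le> sum (w n) A" "sum (w n) A \<le> sum (w n) (X n) / 2" for A
    proof -
      have "vertex_boundary ?E (X n) A \<subseteq> X n" by (auto simp: vertex_boundary_def)
      thus ?thesis
        using exp[of A n] that by (simp add: outer_boundary_eq_vertex_boundary fin msum)
    qed
  qed (use fin w0 W0 c Metric_space.commute[OF met] in auto)
  have finY: "finite Y" using Y(1) fin finite_subset by blast
  define V where "V = sum (w n) Y"
  have V: "0 < V" "sum (w n) (X n) / 2 \<le> V" using Y(2) W0[of n] by (auto simp: V_def)
  have in_Sig: "(n, x) \<in> Sigma UNIV X" if "x \<in> Y" for x using that Y(1) by auto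
  define D where "D x y = Lp_dist p M (f (n, y)) (f (n, x)) powr p" for x y
  have card_le: "card {y. y \<in> Y \<and> ?E x y} \<le> K" if "x \<in> Y" for x
    using K[of x n] that Y(1) fin[of n]
      card_mono[of "{y. y \<in> X n \<and> \<delta> n x y \<le> R}" "{y. y \<in> Y \<and> ?E x y}"]
    by fastforce
  have "(\<Sum>x\<in>Y. \<Sum>y\<in>Y. w n x * w n y * D x y)
      \<le> C * V * (\<Sum>x\<in>Y. w n x * (\<Sum>y | y \<in> Y \<and> ?E x y. D x y))"
    unfolding D_def V_def
    by (rule C(2)[OF Y(3) card_le]) (use f in_Sig in auto)
  also have "\<dots> \<le> C * V * (\<Sum>x\<in>Y. w n x * (real K * \<rho>\<^sub>2 R powr p))"
  proof (intro mult_left_mono sum_mono w0)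
    fix x assume x: "x \<in> Y"
    have "D x y \<le> \<rho>\<^sub>2 R powr p" if "y \<in> Y" "?E x y" for y
    proof -
      have "Lp_dist p M (f (n, y)) (f (n, x)) \<le> \<rho>\<^sub>2 (\<delta> n x y)"
        using upper[OF in_Sig in_Sig, of y x] that x d_eq[of y n x] Metric_space.commute[OF met, of n x y]
        by simp
      also have "\<dots> \<le> \<rho>\<^sub>2 R"
        using that cf(2) dn R by (intro monotone_onD[of "{0..}" "(\<le>)" "(\<le>)" \<rho>\<^sub>2])
          (auto simp: control_function_def)
      finally show ?thesis
        unfolding D_def using p by (intro powr_mono2) (auto simp: Lp_dist_def)
    qed
    hence "(\<Sum>y | y \<in> Y \<and> ?E x y. D x y) \<le> real (card {y. y \<in> Y \<and> ?E x y}) * \<rho>\<^sub>2 R powr p"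
      by (intro sum_bounded_above) auto
    also have "\<dots> \<le> real K * \<rho>\<^sub>2 R powr p"
      using card_le[OF x] by (intro mult_right_mono) auto
    finally show "(\<Sum>y | y \<in> Y \<and> ?E x y. D x y) \<le> real K * \<rho>\<^sub>2 R powr p" .
  qed (use C(1) V in auto)
  also have "\<dots> = B * (V * V)"
    by (simp add: B_def V_def sum_distrib_right[symmetric])
  finally have up: "(\<Sum>x\<in>Y. \<Sum>y\<in>Y. w n x * w n y * D x y) \<le> B * (V * V)" .
  \<comment> \<open>For fixed \<open>x\<close>, the points of \<open>Y\<close> farther than
    \<open>S\<close> carry at least 3/4 of its weight, and at each of them \<open>D\<close> is at
    least \<open>2 * B + 1\<close>.\<close>
  have "(2 * B + 1) * (3 / 4 * V) \<le> (\<Sum>y\<in>Y. w n y * D x y)" if x: "x \<in> Y" for x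
  proof -
    let ?N = "{y. y \<in> Y \<and> \<delta> n x y \<le> S}"
    have "sum (w n) ?N \<le> real (card ?N) * (q * sum (w n) (X n))"
      using Y(1) wq by (intro sum_bounded_above) auto
    also have "\<dots> \<le> real L * (q * sum (w n) (X n))"
    proof (intro mult_right_mono)
      have "card ?N \<le> card {y. y \<in> X n \<and> \<delta> n x y \<le> S}"
        using Y(1) fin[of n] by (intro card_mono) auto
      thus "real (card ?N) \<le> real L" using L[of x n] x Y(1) by fastforce
    qed (use q W0[of n] in auto)
    also have "\<dots> = real L * q * sum (w n) (X n)" by simp
    also have "\<dots> \<le> 1 / 8 * sum (w n) (X n)"
      using W0[of n] by (intro mult_right_mono) (auto simp: q_def field_simps)
    also have "\<dots> \<le> V / 4" using V by simp
    finally have near: "sum (w n) ?N \<le> V / 4" .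
    have "V = sum (w n) (Y - ?N) + sum (w n) ?N"
      unfolding V_def using finY by (intro sum.subset_diff) auto
    with near have "3 / 4 * V \<le> sum (w n) (Y - ?N)" by simp
    hence "(2 * B + 1) * (3 / 4 * V) \<le> (2 * B + 1) * sum (w n) (Y - ?N)"
      using B0 by (intro mult_left_mono) auto
    also have "\<dots> = (\<Sum>y\<in>Y - ?N. w n y * (2 * B + 1))"
      by (simp add: sum_distrib_right[symmetric])
    also have "\<dots> \<le> (\<Sum>y\<in>Y - ?N. w n y * D x y)"
    proof (intro sum_mono mult_left_mono w0)
      fix y assume y: "y \<in> Y - ?N"
      have "2 * B + 1 \<le> \<rho>\<^sub>1 (\<delta> n x y)" using y by (intro far) auto
      also have "\<dots> \<le> Lp_dist p M (f (n, y)) (f (n, x))"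
        using lower[OF in_Sig in_Sig, of y x] y x d_eq[of y n x] subsetD[OF Y(1)]
          Metric_space.commute[OF met, of n x y] by simp
      finally have le: "2 * B + 1 \<le> Lp_dist p M (f (n, y)) (f (n, x))" .
      \<comment> \<open>Since the distance is at least 1 and \<open>p \<ge> 1\<close>, its
        \<open>p\<close>-th power is at least the distance itself.\<close>
      also have "\<dots> = Lp_dist p M (f (n, y)) (f (n, x)) powr 1"
        using le B0 by simp
      also have "\<dots> \<le> D x y"
        unfolding D_def using le B0 assms(5) by (intro powr_mono) auto
      finally show "2 * B + 1 \<le> D x y" .
    qed
    also have "\<dots> \<le> (\<Sum>y\<in>Y. w n y * D x y)"
      using finY w0 by (intro sum_mono2) (auto simp: D_def)
    finally show ?thesis .
  qed
  hence "(\<Sum>x\<in>Y. w n x * ((2 * B + 1) * (3 / 4 * V))) \<le> (\<Sum>x\<in>Y. w n x * (\<Sum>y\<in>Y. w n y * D x y))"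
    by (intro sum_mono mult_left_mono w0)
  also have "\<dots> \<le> B * (V * V)" using up by (simp add: sum_distrib_left mult.assoc)
  also have "(\<Sum>x\<in>Y. w n x * ((2 * B + 1) * (3 / 4 * V))) = (2 * B + 1) * (3 / 4) * (V * V)"
    unfolding sum_distrib_right[symmetric] by (simp add: V_def)
  \<comment> \<open>Both bounds on the double sum are divided by the positive number
    \<open>V * V\<close>; what remains is incompatible with \<open>B \<ge> 0\<close>.\<close>
  finally have "(2 * B + 1) * (3 / 4) \<le> B" using V by simp
  thus False using B0 by simp
qed

end
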